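(* For integers $d,r\ge 2$ let $m=d(r-1)+1$, and let $P(d,r)$ be the maximum, over generic sets of $m$ points in $\mathbb R^d$, of the number of unordered partitions of the set into $r$ parts whose positive hulls have a nonzero point in common. Then for fixed $r$, as $d\to\infty$, \[ P(d,r)\ \ge\ (1-o(1))\,\frac{(r/2)^m}{r!}. \]
   Context: The positive hull of a finite set $\{x_1,\dots,x_k\}\subset\mathbb R^d$ is $\{\sum_i\lambda_ix_i:\lambda_i\ge 0\}$. Such partitions are called conic Tverberg partitions. *)

theory Defs
  imports
    Complex_Main
    "HOL-Library.Disjoint_Sets"
    "HOL-Library.Poly_Mapping"
    "HOL-Library.Landau_Symbols"
    "Jordan_Normal_Form.Matrix"
begin

text \<open>
  Since the dimension tends to infinity, it has to be a term: \<open>\<real>\<^sup>d\<close> is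
  \<^term>\<open>carrier_vec d :: real vec set\<close>.
\<close>

definition pos_hull :: "nat \<Rightarrow> real vec set \<Rightarrow> real vec set" where
  "pos_hull d S = {finsum_vec TYPE(real) d (\<lambda>x. c x \<cdot>\<^sub>v x) S | c. \<forall>x\<in>S. c x \<ge> (0::real)}"

text \<open>
  A polynomial over the rationals in variables from \<^typ>\<open>'v\<close> is a finitely supported
  function from monomials to coefficients, a monomial being a finitely supported function
  from variables to exponents. \<open>eval_mpoly a p\<close> is its value at the point \<open>a\<close>.
\<close>

definition eval_mpoly :: "('v \<Rightarrow> real) \<Rightarrow> (('v \<Rightarrow>\<^sub>0 nat) \<Rightarrow>\<^sub>0 rat) \<Rightarrow> real" where
  "eval_mpoly a p =
     (\<Sum>m\<in>Poly_Mapping.keys p. of_rat (Poly_Mapping.lookup p m) *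
        (\<Prod>v\<in>Poly_Mapping.keys m. a v ^ Poly_Mapping.lookup m v))"

definition algebraically_independent :: "'v set \<Rightarrow> ('v \<Rightarrow> real) \<Rightarrow> bool" where
  "algebraically_independent I a \<longleftrightarrow>
     (\<forall>p. (\<forall>m\<in>Poly_Mapping.keys p. Poly_Mapping.keys m \<subseteq> I) \<and> eval_mpoly a p = 0 \<longrightarrow> p = 0)"

text \<open>
  Generic point sets: all the coordinates of all the points together are algebraically
  independent over the rationals. This implies every general position condition that
  requires nonzero polynomials with rational coefficients not to vanish at the coordinates,
  such as linear general position or strong general position.
\<close>

definition generic :: "nat \<Rightarrow> real vec set \<Rightarrow> bool" where
  "generic d X \<longleftrightarrow> X \<subseteq> carrier_vec d \<and> finite X \<and>
     algebraically_independent (X \<times> {..<d}) (\<lambda>(x, i). x $ i)"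

definition conic_tverberg_partitions :: "nat \<Rightarrow> nat \<Rightarrow> real vec set \<Rightarrow> real vec set set set" where
  "conic_tverberg_partitions d r X =
     {\<P>. partition_on X \<P> \<and> card \<P> = r \<and>
          (\<exists>y. y \<noteq> 0\<^sub>v d \<and> (\<forall>A\<in>\<P>. y \<in> pos_hull d A))}"

definition num_points :: "nat \<Rightarrow> nat \<Rightarrow> nat" where
  "num_points d r = d * (r - 1) + 1"

definition max_conic_tverberg :: "nat \<Rightarrow> nat \<Rightarrow> nat" where
  "max_conic_tverberg d r =
     Max {card (conic_tverberg_partitions d r X) | X. generic d X \<and> card X = num_points d r}"

text \<open>The numbers of which the maximum is taken are bounded, so \<^const>\<open>Max\<close> is meaningful.\<close>

lemma finite_conic_tverberg_counts:
  "finite {card (conic_tverberg_partitions d r X) | X. generic d X \<and> card X = num_points d r}"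
proof (rule finite_subset)
  show "{card (conic_tverberg_partitions d r X) | X. generic d X \<and> card X = num_points d r}
          \<subseteq> {.. 2 ^ 2 ^ num_points d r}"
  proof clarify
    fix X assume X: "generic d X" "card X = num_points d r"
    have fin: "finite X" using X(1) by (simp add: generic_def)
    have "conic_tverberg_partitions d r X \<subseteq> Pow (Pow X)"
      by (auto simp: conic_tverberg_partitions_def partition_on_def)
    then have "card (conic_tverberg_partitions d r X) \<le> card (Pow (Pow X))"
      using fin by (intro card_mono) auto
    also have "\<dots> = 2 ^ 2 ^ num_points d r" using fin X(2) by (simp add: card_Pow)
    finally show "card (conic_tverberg_partitions d r X) \<le> 2 ^ 2 ^ num_points d r" .
  qed
qed simp

end

(*
  Fix points with algebraically independent coordinates and give each of them a sign. For a
  map f from the m points to r colours, the d(r-1) linear equations that say that all colour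
  classes have the same linear combination y have m = d(r-1)+1 unknowns, hence a nonzero
  solution. Absorbing the signs of the coefficients into the points turns it into a solution
  with nonnegative coefficients, so some choice of signs makes f a conic Tverberg partition,
  where y is nonzero as soon as no colour class has more than d points (such classes are
  linearly independent). There are 2^m choices of signs, and almost all of the r^m maps have
  only classes of size at most d, because the mean size is about d(1-1/r). Hence some choice
  of signs serves at least (1-o(1)) (r/2)^m maps, and r! maps describe the same partition.
*)
theory Submission
  imports
    Defs
    "HOL-Analysis.Continuum_Not_Denumerable"
    "Jordan_Normal_Form.Determinant"
begin

section \<open>Existence of algebraically independent reals\<close>

text \<open>
  Exponent vectors are extensional functions here rather than finitely supported ones, which
  makes renaming and adjoining variables elementary.
\<close>

definition monom_independent :: "'v set \<Rightarrow> ('v \<Rightarrow> real) \<Rightarrow> bool" where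
  "monom_independent I a \<longleftrightarrow>
     (\<forall>M c. finite M \<and> M \<subseteq> (I \<rightarrow>\<^sub>E (UNIV :: nat set)) \<and>
        (\<Sum>e\<in>M. of_rat (c e) * (\<Prod>v\<in>I. a v ^ e v)) = 0 \<longrightarrow> (\<forall>e\<in>M. c e = 0))"

text \<open>Sums indexed by arbitrary objects are rewritten as sums over exponent vectors.
  Injectivity prevents two terms from merging, so every coefficient survives unchanged.\<close>

lemma monom_family:
  fixes e :: "'p \<Rightarrow> 'v \<Rightarrow> nat" and a :: "'v \<Rightarrow> real" and c :: "'p \<Rightarrow> rat"
  assumes "finite P" "inj_on (\<lambda>p. restrict (e p) I) P"
  obtains M c' where "finite M" "M \<subseteq> (I \<rightarrow>\<^sub>E UNIV)"
    "\<forall>p\<in>P. restrict (e p) I \<in> M \<and> c' (restrict (e p) I) = c p"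
    "(\<Sum>p\<in>P. of_rat (c p) * (\<Prod>v\<in>I. a v ^ e p v)) =
     (\<Sum>e\<in>M. of_rat (c' e) * (\<Prod>v\<in>I. a v ^ e v))"
proof
  let ?h = "\<lambda>p. restrict (e p) I"
  let ?c' = "\<lambda>x. c (inv_into P ?h x)"
  show "finite (?h ` P)" using assms(1) by simp
  show "?h ` P \<subseteq> (I \<rightarrow>\<^sub>E UNIV)" by auto
  show *: "\<forall>p\<in>P. ?h p \<in> ?h ` P \<and> ?c' (?h p) = c p"
    using inv_into_f_f[OF assms(2)] by simp
  show "(\<Sum>p\<in>P. of_rat (c p) * (\<Prod>v\<in>I. a v ^ e p v)) =
     (\<Sum>e\<in>?h ` P. of_rat (?c' e) * (\<Prod>v\<in>I. a v ^ e v))"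
    unfolding sum.reindex[OF assms(2)] using * by (intro sum.cong) auto
qed

lemma monom_independentD:
  fixes e :: "'p \<Rightarrow> 'v \<Rightarrow> nat" and c :: "'p \<Rightarrow> rat"
  assumes "monom_independent I a" "finite P" "inj_on (\<lambda>p. restrict (e p) I) P"
    and "(\<Sum>p\<in>P. of_rat (c p) * (\<Prod>v\<in>I. a v ^ e p v)) = 0" "p \<in> P"
  shows "c p = 0"
proof -
  obtain M c' where M: "finite M" "M \<subseteq> (I \<rightarrow>\<^sub>E UNIV)"
    and c': "\<forall>p\<in>P. restrict (e p) I \<in> M \<and> c' (restrict (e p) I) = c p"
    and eq: "(\<Sum>p\<in>P. of_rat (c p) * (\<Prod>v\<in>I. a v ^ e p v)) =
     (\<Sum>e\<in>M. of_rat (c' e) * (\<Prod>v\<in>I. a v ^ e v))"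
    by (rule monom_family[OF assms(2,3), of c a])
  have "\<forall>e\<in>M. c' e = 0"
    using assms(1)[unfolded monom_independent_def, rule_format, of M c'] M eq assms(4) by auto
  then show ?thesis using c' assms(5) by metis
qed

lemma countable_funcset_finite_domain:
  assumes "finite I" "countable C"
  shows "countable (I \<rightarrow>\<^sub>E C)"
  using assms(1)
proof (induction I rule: finite_induct)
  case (insert x I)
  then show ?case using assms(2) unfolding PiE_insert_eq by (intro countable_image) auto
qed (simp add: PiE_empty_domain)

text \<open>Induction on the variables, by countability: only countably many nonzero polynomials
  have their coefficients among the rational polynomial expressions in the values already chosen,
  and each has finitely many roots, so some real is a root of none of them and can serve as the next
  value.\<close>

lemma ex_monom_independent:
  fixes I :: "'v set"
  assumes "finite I"
  shows "\<exists>a. monom_independent I a"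
  using assms
proof (induction I rule: finite_induct)
  case empty
  have "monom_independent ({} :: 'v set) (\<lambda>_. 0)"
    unfolding monom_independent_def
  proof (intro allI impI ballI)
    fix M and c :: "_ \<Rightarrow> rat" and e :: "'v \<Rightarrow> nat"
    assume *: "finite M \<and> M \<subseteq> ({} \<rightarrow>\<^sub>E (UNIV :: nat set)) \<and>
       (\<Sum>e\<in>M. of_rat (c e) * (\<Prod>v\<in>{}. (0::real) ^ e v)) = 0" and e: "e \<in> M"
    then have "M = {e}" by (auto simp: PiE_empty_domain)
    then show "c e = 0" using * by auto
  qed
  then show ?case by blast
next
  case (insert v I)
  then obtain a where a: "monom_independent I a" by blast
  \<comment> \<open>\<open>S\<close> is the ring generated over the rationals by the values
    \<open>a v\<close> with \<open>v\<close> in \<open>I\<close>. Coefficient functions are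
    extensional on a finite \<open>M\<close>, so there are only countably many of them.\<close>
  define S where "S = (\<Union>M\<in>{M. finite M \<and> M \<subseteq> (I \<rightarrow>\<^sub>E (UNIV :: nat set))}.
    (\<lambda>c. \<Sum>e\<in>M. of_rat (c e) * (\<Prod>v\<in>I. a v ^ e v)) ` (M \<rightarrow>\<^sub>E (UNIV :: rat set)))"
  have "countable S"
    unfolding S_def using insert(1)
    by (intro countable_UN countable_image countable_funcset_finite_domain countable_Collect_finite_subset) auto
  define Q where "Q = {p :: real poly. p \<noteq> 0 \<and> (\<forall>k. coeff p k \<in> S)}"
  have "Q \<subseteq> Poly ` lists S"
  proof
    fix p assume "p \<in> Q"
    then have "coeffs p \<in> lists S"
      by (auto simp: Q_def coeffs_def)
    then show "p \<in> Poly ` lists S" by (metis Poly_coeffs image_eqI)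
  qed
  then have "countable Q"
    using \<open>countable S\<close> by (meson countable_image countable_lists countable_subset)
  have "countable (\<Union>p\<in>Q. {t. poly p t = 0})"
    by (rule countable_UN[OF \<open>countable Q\<close>])
      (auto simp: Q_def intro: countable_finite poly_roots_finite)
  then obtain t where t: "t \<notin> (\<Union>p\<in>Q. {t. poly p t = 0})"
    using uncountable_UNIV_real by (metis UNIV_eq_I)
  \<comment> \<open>Sorting a relation by powers of \<open>t\<close> gives a polynomial with coefficients in \<open>S\<close> and root \<open>t\<close>.\<close>
  have "monom_independent (insert v I) (a(v := t))"
    unfolding monom_independent_def
  proof (intro allI impI ballI, elim conjE)
    fix M and c :: "('v \<Rightarrow> nat) \<Rightarrow> rat" and e0
    assume fin: "finite M" and M: "M \<subseteq> (insert v I \<rightarrow>\<^sub>E (UNIV :: nat set))" and e0: "e0 \<in> M"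
      and 0: "(\<Sum>e\<in>M. of_rat (c e) * (\<Prod>w\<in>insert v I. (a(v := t)) w ^ e w)) = 0"
    have prd: "(\<Prod>w\<in>insert v I. (a(v := t)) w ^ e w) = (\<Prod>w\<in>I. a w ^ e w) * t ^ e v" for e
    proof -
      have "(\<Prod>w\<in>I. (a(v := t)) w ^ e w) = (\<Prod>w\<in>I. a w ^ e w)"
        using insert(2) by (intro prod.cong) auto
      then show ?thesis using insert(1,2) by simp
    qed
    define p where "p = (\<Sum>e\<in>M. monom (of_rat (c e) * (\<Prod>w\<in>I. a w ^ e w)) (e v))"
    define N where "N k = {e\<in>M. e v = k}" for k
    have co: "coeff p k = (\<Sum>e\<in>N k. of_rat (c e) * (\<Prod>w\<in>I. a w ^ e w))" for k
      unfolding p_def N_def coeff_sum coeff_monom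
      using fin by (simp add: sum.inter_filter)
    \<comment> \<open>The exponent of \<open>v\<close> is constant on \<open>N k\<close>, so
      forgetting it identifies no two exponent vectors.\<close>
    have inj: "inj_on (\<lambda>e. restrict e I) (N k)" for k
    proof (rule inj_onI)
      fix e e' assume e: "e \<in> N k" "e' \<in> N k" "restrict e I = restrict e' I"
      have "e \<in> insert v I \<rightarrow>\<^sub>E UNIV" "e' \<in> insert v I \<rightarrow>\<^sub>E UNIV"
        using e(1,2) M unfolding N_def by blast+
      then show "e = e'"
      proof (rule PiE_ext)
        fix w assume "w \<in> insert v I"
        then consider "w = v" | "w \<in> I" by blast
        then show "e w = e' w"
        proof cases
          case 1
          then show ?thesis using e(1,2) by (simp add: N_def)
        next
          case 2
          then show ?thesis using fun_cong[OF e(3), of w] by simp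
        qed
      qed
    qed
    have "finite (N k)" for k using fin by (simp add: N_def)
    have "coeff p k \<in> S" for k
    proof -
      obtain M' c' where M': "finite M'" "M' \<subseteq> (I \<rightarrow>\<^sub>E UNIV)"
        and "\<forall>e\<in>N k. restrict e I \<in> M' \<and> c' (restrict e I) = c e"
        and eq: "coeff p k = (\<Sum>e\<in>M'. of_rat (c' e) * (\<Prod>v\<in>I. a v ^ e v))"
        unfolding co by (rule monom_family[OF \<open>finite (N k)\<close> inj, of c a])
      have "coeff p k = (\<Sum>e\<in>M'. of_rat (restrict c' M' e) * (\<Prod>v\<in>I. a v ^ e v))"
        unfolding eq by (intro sum.cong) auto
      moreover have "restrict c' M' \<in> (M' \<rightarrow>\<^sub>E UNIV)" by auto
      ultimately show ?thesis unfolding S_def using M' by blast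
    qed
    moreover have "poly p t = 0"
      using 0 unfolding prd p_def by (simp add: poly_sum poly_monom mult.assoc)
    ultimately have "p = 0" using t unfolding Q_def by blast
    then have "(\<Sum>e\<in>N (e0 v). of_rat (c e) * (\<Prod>w\<in>I. a w ^ e w)) = 0"
      using co by (metis coeff_0)
    then show "c e0 = 0"
      by (rule monom_independentD[OF a \<open>finite (N (e0 v))\<close> inj]) (simp add: N_def e0)
  qed
  then show ?case by blast
qed

text \<open>Scaling variables by nonzero rationals multiplies each monomial by a nonzero rational,
  which its coefficient absorbs. Hence sign changes preserve genericity. The bijection
  \<open>g\<close> renames pairs of indices to pairs of a point and a coordinate.\<close>

lemma algebraically_independent_scaled:
  assumes a: "monom_independent I a" and I: "finite I" and g: "bij_betw g I J"
    and b: "\<And>v. v \<in> I \<Longrightarrow> b (g v) = of_rat (s v) * a v" and s: "\<And>v. v \<in> I \<Longrightarrow> s v \<noteq> 0"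
  shows "algebraically_independent J b"
  unfolding algebraically_independent_def
proof (intro allI impI, elim conjE)
  fix p :: "('b \<Rightarrow>\<^sub>0 nat) \<Rightarrow>\<^sub>0 rat"
  assume J: "\<forall>m\<in>Poly_Mapping.keys p. Poly_Mapping.keys m \<subseteq> J" and 0: "eval_mpoly b p = 0"
  have J_eq: "J = g ` I" and "finite J" and inj_g: "inj_on g I"
    using g I by (auto simp: bij_betw_def)
  let ?e = "\<lambda>m v. Poly_Mapping.lookup m (g v)"
  let ?c = "\<lambda>m. Poly_Mapping.lookup p m * (\<Prod>v\<in>I. s v ^ ?e m v)"
  have prd: "(\<Prod>v\<in>Poly_Mapping.keys m. b v ^ Poly_Mapping.lookup m v)
      = of_rat (\<Prod>v\<in>I. s v ^ ?e m v) * (\<Prod>v\<in>I. a v ^ ?e m v)"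
    if "m \<in> Poly_Mapping.keys p" for m
  proof -
    have "(\<Prod>v\<in>Poly_Mapping.keys m. b v ^ Poly_Mapping.lookup m v)
        = (\<Prod>v\<in>J. b v ^ Poly_Mapping.lookup m v)"
      using J that \<open>finite J\<close> by (intro prod.mono_neutral_left) (auto simp: in_keys_iff)
    also have "\<dots> = (\<Prod>v\<in>I. b (g v) ^ ?e m v)"
      unfolding J_eq by (simp add: prod.reindex[OF inj_g])
    also have "\<dots> = (\<Prod>v\<in>I. of_rat (s v) ^ ?e m v * a v ^ ?e m v)"
      using b by (intro prod.cong) (auto simp: power_mult_distrib)
    finally show ?thesis by (simp add: prod.distrib of_rat_prod of_rat_power)
  qed
  have sum0: "(\<Sum>m\<in>Poly_Mapping.keys p. of_rat (?c m) * (\<Prod>v\<in>I. a v ^ ?e m v)) = 0"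
    using 0 prd unfolding eval_mpoly_def by (simp add: of_rat_mult mult.assoc)
  have inj: "inj_on (\<lambda>m. restrict (?e m) I) (Poly_Mapping.keys p)"
  proof (intro inj_onI poly_mapping_eqI)
    fix m m' w
    assume m: "m \<in> Poly_Mapping.keys p" "m' \<in> Poly_Mapping.keys p"
      and eq: "restrict (?e m) I = restrict (?e m') I"
    show "Poly_Mapping.lookup m w = Poly_Mapping.lookup m' w"
    proof (cases "w \<in> J")
      case True
      then obtain v where "v \<in> I" "w = g v" unfolding J_eq by blast
      then show ?thesis using fun_cong[OF eq, of v] by simp
    next
      case False
      then have "w \<notin> Poly_Mapping.keys m" "w \<notin> Poly_Mapping.keys m'" using J m by blast+
      then show ?thesis by (simp add: in_keys_iff)
    qed
  qed
  have "?c m = 0" if "m \<in> Poly_Mapping.keys p" for m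
    using monom_independentD[OF a finite_keys inj, of ?c] sum0 that by blast
  then have "Poly_Mapping.keys p = {}" using I s by (fastforce simp: in_keys_iff)
  then show "p = 0" by simp
qed

section \<open>Linear algebra: general position and underdetermined systems\<close>

text \<open>The Leibniz formula is a nontrivial relation between monomials if the determinant vanishes.\<close>

lemma monom_independent_imp_linear_independent:
  fixes a :: "nat \<times> nat \<Rightarrow> real"
  assumes a: "monom_independent ({..<m} \<times> {..<d}) a"
    and A: "A \<subseteq> {..<m}" "card A \<le> d"
    and 0: "\<And>i. i < d \<Longrightarrow> (\<Sum>k\<in>A. l k * a (k, i)) = 0"
    and k: "k \<in> A"
  shows "l k = 0"
proof (rule ccontr)
  assume lk: "l k \<noteq> 0"
  let ?I = "{..<m} \<times> {..<d}"
  define n where "n = card A"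
  have "finite A" using A(1) finite_subset by blast
  then obtain h where h: "bij_betw h {0..<n} A" using ex_bij_betw_nat_finite n_def by blast
  have nd: "n \<le> d" using A(2) by (simp add: n_def)
  \<comment> \<open>The first \<open>n\<close> coordinates already suffice; they exist because
    \<open>card A \<le> d\<close>, and they make the matrix square.\<close>
  define B where "B = mat n n (\<lambda>(i, t). a (h t, i))"
  define v where "v = vec n (\<lambda>t. l (h t))"
  have "v \<in> carrier_vec n" "B \<in> carrier_mat n n" by (simp_all add: v_def B_def)
  moreover have "v \<noteq> 0\<^sub>v n"
  proof
    assume v0: "v = 0\<^sub>v n"
    obtain t where t: "t < n" "k = h t"
      using k h by (metis atLeastLessThan_iff bij_betw_iff_bijections)
    then have "v $ t = l k" by (simp add: v_def)
    then show False using v0 lk t by simp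
  qed
  moreover have "B *\<^sub>v v = 0\<^sub>v n"
  proof (rule eq_vecI)
    fix i assume i: "i < dim_vec (0\<^sub>v n :: real vec)"
    have "(B *\<^sub>v v) $ i = (\<Sum>t\<in>{0..<n}. l (h t) * a (h t, i))"
      using i by (simp add: B_def v_def scalar_prod_def mult.commute)
    also have "\<dots> = (\<Sum>k\<in>A. l k * a (k, i))"
      using sum.reindex_bij_betw[OF h, of "\<lambda>k. l k * a (k, i)"] by simp
    finally show "(B *\<^sub>v v) $ i = 0\<^sub>v n $ i" using 0 i nd by simp
  qed (simp add: B_def)
  ultimately have "det B = 0" using det_0_iff_vec_prod_zero_field by blast
  let ?P = "{p. p permutes {0..<n}}"
  \<comment> \<open>Each Leibniz term is a squarefree monomial whose exponent vector is the
    indicator of the graph of \<open>h \<circ> p\<close>. Different permutations therefore give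
    different monomials, and independence would force the sign of the identity to be 0.\<close>
  define e where "e p = (\<lambda>w. if w \<in> (\<lambda>i. (h (p i), i)) ` {0..<n} then 1 else 0 :: nat)" for p
  have perm_less: "p i < n" if "p \<in> ?P" "i < n" for p i
    using that permutes_in_image[of p "{0..<n}" i] by auto
  have ran: "h (p i) < m" if "p \<in> ?P" "i < n" for p i
    using perm_less[OF that] h A(1) by (force simp: bij_betw_def)
  have prd: "(\<Prod>w\<in>?I. a w ^ e p w) = (\<Prod>i=0..<n. B $$ (i, p i))" if p: "p \<in> ?P" for p
  proof -
    let ?G = "(\<lambda>i. (h (p i), i)) ` {0..<n}"
    have "?G \<subseteq> ?I" using ran[OF p] nd by auto
    then have "(\<Prod>w\<in>?I. a w ^ e p w) = (\<Prod>w\<in>?G. a w ^ e p w)"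
      by (intro prod.mono_neutral_right) (auto simp: e_def)
    also have "\<dots> = (\<Prod>w\<in>?G. a w)" by (intro prod.cong) (auto simp: e_def)
    also have "\<dots> = (\<Prod>i=0..<n. a (h (p i), i))"
      by (subst prod.reindex) (auto simp: inj_on_def)
    also have "\<dots> = (\<Prod>i=0..<n. B $$ (i, p i))"
      using perm_less[OF p] by (intro prod.cong) (auto simp: B_def)
    finally show ?thesis .
  qed
  have inj: "inj_on (\<lambda>p. restrict (e p) ?I) ?P"
  proof (intro inj_onI ext)
    fix p q i assume p: "p \<in> ?P" and q: "q \<in> ?P" and eq: "restrict (e p) ?I = restrict (e q) ?I"
    show "p i = q i"
    proof (cases "i < n")
      case True
      then have "(h (p i), i) \<in> ?I" using ran[OF p] nd by auto
      then have "e q (h (p i), i) = e p (h (p i), i)"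
        using fun_cong[OF eq, of "(h (p i), i)"] by simp
      also have "\<dots> = 1" using True by (auto simp: e_def)
      finally have "h (p i) = h (q i)" by (auto simp: e_def split: if_splits)
      then show ?thesis
        using perm_less[OF p True] perm_less[OF q True] h by (auto simp: bij_betw_def inj_on_def)
    next
      case False
      then show ?thesis using p q by (simp add: permutes_def)
    qed
  qed
  have "(\<Sum>p\<in>?P. of_rat (signof p) * (\<Prod>w\<in>?I. a w ^ e p w)) = det B"
    unfolding det_def' [OF \<open>B \<in> carrier_mat n n\<close>]
    using prd by (intro sum.cong) (auto simp: sign_def)
  then have "(\<Sum>p\<in>?P. of_rat (signof p) * (\<Prod>w\<in>?I. a w ^ e p w)) = 0"
    using \<open>det B = 0\<close> by simp
  moreover have "finite ?P" by (simp add: finite_permutations)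
  moreover have "id \<in> ?P" by (simp add: permutes_id)
  ultimately have "(signof (id :: nat \<Rightarrow> nat) :: rat) = 0"
    using monom_independentD[OF a _ inj, of signof id] by blast
  then show False by simp
qed

text \<open>Gaussian elimination by induction on the equations: an equation with zero coefficients
  is dropped; any other one eliminates an unknown \<open>j0\<close>, which lowers both counts by
  one.\<close>

lemma homogeneous_system_solution:
  fixes a :: "'i \<Rightarrow> 'j \<Rightarrow> 'a :: field"
  assumes "finite I" "finite J" "card I < card J"
  shows "\<exists>l. (\<exists>j\<in>J. l j \<noteq> 0) \<and> (\<forall>i\<in>I. (\<Sum>j\<in>J. a i j * l j) = 0)"
  using assms
proof (induction I arbitrary: J a rule: finite_induct)
  case empty
  then obtain j where "j \<in> J" by fastforce
  then show ?case by (intro exI[of _ "\<lambda>_. 1"]) auto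
next
  case (insert i0 I)
  show ?case
  proof (cases "\<forall>j\<in>J. a i0 j = 0")
    case True
    have "card I < card J" using insert by simp
    then obtain l where "\<exists>j\<in>J. l j \<noteq> 0" "\<forall>i\<in>I. (\<Sum>j\<in>J. a i j * l j) = 0"
      using insert.IH[OF insert.prems(1), of a] by blast
    moreover have "(\<Sum>j\<in>J. a i0 j * l j) = 0" using True by simp
    ultimately show ?thesis by blast
  next
    case False
    then obtain j0 where j0: "j0 \<in> J" "a i0 j0 \<noteq> 0" by blast
    let ?J = "J - {j0}"
    define b where "b i j = a i j - a i j0 * a i0 j / a i0 j0" for i j
    have "finite ?J" "card I < card ?J" using insert j0 by auto
    then obtain l where l: "\<exists>j\<in>?J. l j \<noteq> 0" "\<forall>i\<in>I. (\<Sum>j\<in>?J. b i j * l j) = 0"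
      using insert.IH[of ?J b] by blast
    \<comment> \<open>The value of the eliminated unknown, found by solving equation
      \<open>i0\<close> for it.\<close>
    define z where "z = - (\<Sum>j\<in>?J. a i0 j * l j) / a i0 j0"
    have split: "(\<Sum>j\<in>J. a i j * (l(j0 := z)) j) = a i j0 * z + (\<Sum>j\<in>?J. a i j * l j)" for i
      using insert.prems(1) j0(1) by (simp add: sum.remove)
    have "(\<Sum>j\<in>J. a i j * (l(j0 := z)) j) = 0" if "i \<in> I" for i
    proof -
      have "(\<Sum>j\<in>?J. b i j * l j) = (\<Sum>j\<in>?J. a i j * l j - a i j0 / a i0 j0 * (a i0 j * l j))"
        by (intro sum.cong) (auto simp: b_def algebra_simps)
      also have "\<dots> = (\<Sum>j\<in>?J. a i j * l j) - a i j0 / a i0 j0 * (\<Sum>j\<in>?J. a i0 j * l j)"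
        by (simp add: sum_subtractf sum_distrib_left)
      also have "\<dots> = (\<Sum>j\<in>?J. a i j * l j) + a i j0 * z"
        by (simp add: z_def)
      finally show ?thesis using l(2) that split[of i] by (simp add: add.commute)
    qed
    moreover have "(\<Sum>j\<in>J. a i0 j * (l(j0 := z)) j) = 0"
      unfolding split using j0(2) by (simp add: z_def)
    moreover have "\<exists>j\<in>J. (l(j0 := z)) j \<noteq> 0" using l(1) by auto
    ultimately show ?thesis by blast
  qed
qed

section \<open>Signed points and colour classes\<close>

text \<open>The signs are rational numbers because the scaling factors must not leave the field over
  which independence is measured.\<close>

definition signed_point :: "(nat \<times> nat \<Rightarrow> real) \<Rightarrow> nat \<Rightarrow> (nat \<Rightarrow> rat) \<Rightarrow> nat \<Rightarrow> real vec" where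
  "signed_point a d s k = vec d (\<lambda>i. of_rat (s k) * a (k, i))"

definition fibre :: "nat \<Rightarrow> (nat \<Rightarrow> nat) \<Rightarrow> nat \<Rightarrow> nat set" where
  "fibre m f j = {k\<in>{..<m}. f k = j}"

lemma fibre_subset: "fibre m f j \<subseteq> {..<m}" and finite_fibre [simp]: "finite (fibre m f j)"
  by (auto simp: fibre_def)

text \<open>Two equal points would be a linear dependence between two of the unsigned points, which
  \<open>2 \<le> d\<close> places within the range of general position.\<close>

lemma inj_on_signed_point:
  assumes a: "monom_independent ({..<m} \<times> {..<d}) a" and "2 \<le> d"
    and s: "\<And>k. k < m \<Longrightarrow> s k \<noteq> 0"
  shows "inj_on (signed_point a d s) {..<m}"
proof (rule inj_onI, rule ccontr)
  fix k k' assume k: "k \<in> {..<m}" "k' \<in> {..<m}" "k \<noteq> k'"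
    and eq: "signed_point a d s k = signed_point a d s k'"
  define l where "l x = (if x = k then real_of_rat (s k) else - of_rat (s k'))" for x
  have 0: "(\<Sum>x\<in>{k, k'}. l x * a (x, i)) = 0" if "i < d" for i
  proof -
    have "signed_point a d s k $ i = signed_point a d s k' $ i" using eq by simp
    then show ?thesis using that k(3) by (simp add: l_def signed_point_def)
  qed
  have "l k = 0"
    by (rule monom_independent_imp_linear_independent[OF a _ _ 0]) (use k \<open>2 \<le> d\<close> in auto)
  then show False using s[of k] k by (simp add: l_def)
qed

lemma generic_signed_points:
  assumes a: "monom_independent ({..<m} \<times> {..<d}) a" and "2 \<le> d"
    and s: "\<And>k. k < m \<Longrightarrow> s k \<noteq> 0"
  shows "generic d (signed_point a d s ` {..<m})"
  unfolding generic_def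
proof (intro conjI)
  let ?x = "signed_point a d s"
  have "inj_on ?x {..<m}" using a \<open>2 \<le> d\<close> s by (rule inj_on_signed_point)
  then have bij: "bij_betw (\<lambda>(k, i). (?x k, i)) ({..<m} \<times> {..<d}) (?x ` {..<m} \<times> {..<d})"
    by (auto simp: bij_betw_def inj_on_def image_iff)
  show "algebraically_independent (?x ` {..<m} \<times> {..<d}) (\<lambda>(x, i). x $ i)"
    by (rule algebraically_independent_scaled[OF a _ bij, where s = "\<lambda>(k, i). s k"])
      (use s in \<open>auto simp: signed_point_def\<close>)
qed (auto simp: signed_point_def)

section \<open>From colourings to conic Tverberg partitions\<close>

definition fibre_partition :: "nat \<Rightarrow> nat \<Rightarrow> (nat \<Rightarrow> 'a) \<Rightarrow> (nat \<Rightarrow> nat) \<Rightarrow> 'a set set" where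
  "fibre_partition m r x f = (\<lambda>j. x ` fibre m f j) ` {..<r}"

text \<open>The signs are read off from a solution of the linear system. The bound on the classes
  enters twice: it makes every class nonempty, and it makes the common point nonzero.\<close>

lemma ex_signs_fibre_partition:
  assumes a: "monom_independent ({..<m} \<times> {..<d}) a" and d: "2 \<le> d"
    and m: "m = num_points d r"
    and f: "f \<in> {..<m} \<rightarrow>\<^sub>E {..<r}" and small: "\<And>j. j < r \<Longrightarrow> card (fibre m f j) \<le> d"
  shows "\<exists>s\<in>{..<m} \<rightarrow>\<^sub>E {-1, 1}.
    fibre_partition m r (signed_point a d s) f \<in>
      conic_tverberg_partitions d r (signed_point a d s ` {..<m})"
proof -
  have fr: "f k < r" if "k < m" for k using f that by auto
  \<comment> \<open>Equation \<open>(j, i)\<close> compares coordinate \<open>i\<close> of the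
    combination over colour \<open>j\<close> with that over the reference colour
    \<open>r - 1\<close>, which gives \<open>(r - 1) * d\<close> equations in \<open>m\<close>
    unknowns.\<close>
  define A where "A = (\<lambda>(j, i) k. (if f k = j then a (k, i) else 0) - (if f k = r - 1 then a (k, i) else 0))"
  have "card ({..<r - 1} \<times> {..<d}) < card {..<m}" by (simp add: m num_points_def)
  then obtain l where l0: "\<exists>k\<in>{..<m}. l k \<noteq> 0"
    and l: "\<forall>w\<in>{..<r - 1} \<times> {..<d}. (\<Sum>k\<in>{..<m}. A w k * l k) = 0"
    using homogeneous_system_solution[of "{..<r - 1} \<times> {..<d}" "{..<m}" A] by auto
  define V where "V j i = (\<Sum>k\<in>fibre m f j. l k * a (k, i))" for j i
  have V: "V j i = (\<Sum>k\<in>{..<m}. (if f k = j then a (k, i) else 0) * l k)" for j i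
    unfolding V_def fibre_def by (subst sum.inter_filter) (auto intro!: sum.cong)
  have V_eq: "V j i = V (r - 1) i" if "j < r" "i < d" for j i
  proof (cases "j = r - 1")
    case False
    then have "(\<Sum>k\<in>{..<m}. A (j, i) k * l k) = 0" using l that by auto
    then show ?thesis unfolding V A_def by (simp add: left_diff_distrib sum_subtractf)
  qed simp
  \<comment> \<open>Where \<open>l k = 0\<close> the sign is arbitrary but must not be 0, so that
    the points stay distinct.\<close>
  define s :: "nat \<Rightarrow> rat" where "s = (\<lambda>k\<in>{..<m}. if l k < 0 then -1 else 1)"
  have s: "s \<in> {..<m} \<rightarrow>\<^sub>E {-1, 1}" by (auto simp: s_def)
  have s_abs: "\<bar>l k\<bar> * of_rat (s k) = l k" if "k < m" for k
    using that by (simp add: s_def)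
  let ?x = "signed_point a d s"
  have inj: "inj_on ?x {..<m}"
    by (rule inj_on_signed_point[OF a d]) (simp add: s_def)
  have nonempty: "fibre m f j0 \<noteq> {}" if "j0 < r" for j0
  proof
    assume e: "fibre m f j0 = {}"
    \<comment> \<open>The other \<open>r - 1\<close> classes contain at most
      \<open>(r - 1) * d = m - 1\<close> points, too few to cover everything.\<close>
    have "{..<m} = (\<Union>j\<in>{..<r} - {j0}. fibre m f j)" using fr e by (auto simp: fibre_def)
    then have "m \<le> (\<Sum>j\<in>{..<r} - {j0}. card (fibre m f j))"
      using card_UN_le[of "{..<r} - {j0}" "fibre m f"] by (metis card_lessThan finite_Diff finite_lessThan)
    also have "\<dots> \<le> (\<Sum>j\<in>{..<r} - {j0}. d)" using small by (intro sum_mono) auto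
    also have "\<dots> = (r - 1) * d" using that by simp
    finally show False by (simp add: m num_points_def)
  qed
  have part_disj: "?x ` fibre m f j \<inter> ?x ` fibre m f j' = {}" if "j \<noteq> j'" for j j'
    using that inj by (auto simp: fibre_def inj_on_def)
  have partition: "partition_on (?x ` {..<m}) (fibre_partition m r ?x f)"
  proof (rule partition_onI)
    show "\<Union> (fibre_partition m r ?x f) = ?x ` {..<m}"
      using fr by (auto simp: fibre_partition_def fibre_def)
  next
    fix p q assume "p \<in> fibre_partition m r ?x f" "q \<in> fibre_partition m r ?x f" and pq: "p \<noteq> q"
    then obtain j j' where "p = ?x ` fibre m f j" "q = ?x ` fibre m f j'"
      unfolding fibre_partition_def by blast
    then show "disjnt p q" using pq part_disj[of j j'] unfolding disjnt_def by blast
  next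
    show "{} \<notin> fibre_partition m r ?x f" using nonempty by (auto simp: fibre_partition_def)
  qed
  have "inj_on (\<lambda>j. ?x ` fibre m f j) {..<r}"
  proof (rule inj_onI, rule ccontr)
    fix j j' assume "j \<in> {..<r}" "?x ` fibre m f j = ?x ` fibre m f j'" "j \<noteq> j'"
    then show False using part_disj[of j j'] nonempty[of j] by simp
  qed
  then have card: "card (fibre_partition m r ?x f) = r"
    unfolding fibre_partition_def by (simp add: card_image)
  define y where "y = vec d (V (r - 1))"
  have "y \<noteq> 0\<^sub>v d"
  proof
    assume y0: "y = 0\<^sub>v d"
    \<comment> \<open>If \<open>y\<close> vanished, the class of a point with nonzero coefficient
      would be linearly dependent despite having at most \<open>d\<close> points.\<close>
    obtain k where k: "k < m" "l k \<noteq> 0" using l0 by auto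
    have "V (f k) i = 0" if "i < d" for i
    proof -
      have "V (f k) i = y $ i" using V_eq[OF fr[OF k(1)] that] that by (simp add: y_def)
      then show ?thesis using y0 that by simp
    qed
    then have "l k = 0" unfolding V_def
      by (rule monom_independent_imp_linear_independent[OF a fibre_subset small[OF fr[OF k(1)]]])
        (auto simp: fibre_def k)
    then show False using k by simp
  qed
  moreover have "y \<in> pos_hull d (?x ` fibre m f j)" if j: "j < r" for j
  proof -
    \<comment> \<open>The sign of \<open>l k\<close> now sits in the point, so its absolute value
      remains as the nonnegative coefficient.\<close>
    define c where "c v = \<bar>l (inv_into {..<m} ?x v)\<bar>" for v
    have cx: "c (?x k) = \<bar>l k\<bar>" if "k < m" for k
      using that inj by (simp add: c_def)
    have injj: "inj_on ?x (fibre m f j)" by (rule inj_on_subset[OF inj fibre_subset])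
    have "y = finsum_vec TYPE(real) d (\<lambda>v. c v \<cdot>\<^sub>v v) (?x ` fibre m f j)" (is "_ = ?s")
    proof (rule eq_vecI)
      have car: "(\<lambda>v. c v \<cdot>\<^sub>v v) \<in> ?x ` fibre m f j \<rightarrow> carrier_vec d"
        by (auto simp: signed_point_def)
      show "dim_vec y = dim_vec ?s"
        using finsum_vec_closed[OF car] by (simp add: y_def carrier_vecD)
      fix i assume "i < dim_vec ?s"
      then have i: "i < d" using finsum_vec_closed[OF car] by (simp add: carrier_vecD)
      have "?s $ i = (\<Sum>v\<in>?x ` fibre m f j. (c v \<cdot>\<^sub>v v) $ i)"
        by (rule index_finsum_vec[OF _ i car]) simp
      also have "\<dots> = (\<Sum>k\<in>fibre m f j. (c (?x k) \<cdot>\<^sub>v ?x k) $ i)"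
        by (simp add: sum.reindex[OF injj])
      also have "\<dots> = V j i"
        unfolding V_def
      proof (intro sum.cong refl)
        fix k assume "k \<in> fibre m f j"
        then have k: "k < m" by (simp add: fibre_def)
        have "(c (?x k) \<cdot>\<^sub>v ?x k) $ i = \<bar>l k\<bar> * of_rat (s k) * a (k, i)"
          using i cx[OF k] by (simp add: signed_point_def)
        then show "(c (?x k) \<cdot>\<^sub>v ?x k) $ i = l k * a (k, i)" using s_abs[OF k] by simp
      qed
      finally show "y $ i = ?s $ i" using V_eq[OF j i] i by (simp add: y_def)
    qed
    then show ?thesis unfolding pos_hull_def by (auto simp: c_def)
  qed
  ultimately show ?thesis
    using s partition card unfolding conic_tverberg_partitions_def
    by (intro bexI[of _ s]) (auto simp: fibre_partition_def)
qed

text \<open>A map is determined by which part carries which colour. This labelling is an injection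
  of the \<open>r\<close> colours into the \<open>r\<close> parts, and there are
  \<open>fact r\<close> of those.\<close>

lemma card_fibre_partition_vimage_le:
  assumes inj: "inj_on x {..<m}" and card: "card P = r" and "finite P"
  shows "card {f \<in> {..<m} \<rightarrow>\<^sub>E {..<r}. fibre_partition m r x f = P} \<le> fact r"
proof -
  let ?F = "{f \<in> {..<m} \<rightarrow>\<^sub>E {..<r}. fibre_partition m r x f = P}"
  let ?G = "{g \<in> {..<r} \<rightarrow>\<^sub>E P. inj_on g {..<r}}"
  let ?h = "\<lambda>f. (\<lambda>j\<in>{..<r}. x ` fibre m f j)"
  have "inj_on ?h ?F"
  proof (rule inj_onI)
    fix f f' assume f: "f \<in> ?F" "f' \<in> ?F" and eq: "?h f = ?h f'"
    show "f = f'"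
    proof (rule PiE_ext)
      show "f \<in> {..<m} \<rightarrow>\<^sub>E {..<r}" "f' \<in> {..<m} \<rightarrow>\<^sub>E {..<r}" using f by auto
      fix k assume k: "k \<in> {..<m}"
      then have "f k < r" using f by auto
      then have "x ` fibre m f (f k) = x ` fibre m f' (f k)"
        using fun_cong[OF eq, of "f k"] by simp
      then have "fibre m f (f k) = fibre m f' (f k)"
        using inj_on_image_eq_iff[OF inj fibre_subset fibre_subset] by simp
      moreover have "k \<in> fibre m f (f k)" using k by (simp add: fibre_def)
      ultimately have "k \<in> fibre m f' (f k)" by (rule subst)
      then show "f k = f' k" by (simp add: fibre_def)
    qed
  qed
  moreover have "?h ` ?F \<subseteq> ?G"
  proof (rule image_subsetI)
    fix f assume "f \<in> ?F"
    then have "P = fibre_partition m r x f" by simp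
    \<comment> \<open>The labelling has \<open>r\<close> different values on \<open>r\<close>
      colours, hence repeats none.\<close>
    have "inj_on (\<lambda>j. x ` fibre m f j) {..<r}"
      using card \<open>P = fibre_partition m r x f\<close> by (intro eq_card_imp_inj_on) (auto simp: fibre_partition_def)
    then show "?h f \<in> ?G"
      using \<open>P = _\<close> by (auto simp: fibre_partition_def inj_on_def)
  qed
  moreover have "finite ?G" using \<open>finite P\<close> by (intro finite_subset[OF _ finite_PiE[of "{..<r}" "\<lambda>_. P"]]) auto
  ultimately have "card ?F \<le> card ?G" by (rule card_inj_on_le)
  also have "card ?G = fact r"
    using card_inj_on_subset_funcset[of "{..<r}" P "{..<r}"] card \<open>finite P\<close>
    by (simp add: fact_prod_rev)
  finally show ?thesis .
qed

section \<open>Counting colourings with a large class\<close>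

text \<open>The exponential moment method with parameter \<open>1 + 1 / r\<close>.\<close>

lemma card_large_fibre_le:
  fixes d r j :: nat
  assumes r: "2 \<le> r" and j: "j < r" and m: "m = num_points d r"
  defines "q \<equiv> (1 + 1 / real r ^ 2) ^ (r - 1) / (1 + 1 / real r)"
  shows "real (card {f \<in> {..<m} \<rightarrow>\<^sub>E {..<r}. d < card (fibre m f j)}) \<le> q ^ d * real r ^ m"
proof -
  define t where "t = 1 + 1 / real r"
  \<comment> \<open>Weighting colour \<open>j\<close> by \<open>t\<close> and the others by 1,
    \<open>u\<close> is the mean weight of a colour: \<open>t + r - 1 = r * u\<close>.\<close>
  define u where "u = 1 + 1 / real r ^ 2"
  let ?F = "{..<m} \<rightarrow>\<^sub>E {..<r}"
  let ?B = "{f \<in> ?F. d < card (fibre m f j)}"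
  have t1: "t \<ge> 1" by (simp add: t_def)
  have fin: "finite ?F" by (simp add: finite_PiE)
  have pw: "t ^ card (fibre m f j) = (\<Prod>k\<in>{..<m}. if f k = j then t else 1)" for f
    unfolding fibre_def by (simp add: prod.If_cases Int_def)
  \<comment> \<open>Markov's inequality in counting form: a map in \<open>?B\<close> has at least
    \<open>d + 1\<close> points of colour \<open>j\<close>, so its weight is at least
    \<open>t ^ (d + 1)\<close>. The total weight then factorises over the points.\<close>
  have "real (card ?B) * t ^ (d + 1) = (\<Sum>f\<in>?B. t ^ (d + 1))" by simp
  also have "\<dots> \<le> (\<Sum>f\<in>?B. t ^ card (fibre m f j))"
    using t1 by (intro sum_mono power_increasing) auto
  also have "\<dots> \<le> (\<Sum>f\<in>?F. t ^ card (fibre m f j))"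
    using t1 fin by (intro sum_mono2) auto
  also have "\<dots> = (\<Prod>k\<in>{..<m}. \<Sum>i\<in>{..<r}. if i = j then t else 1)"
    unfolding pw by (subst prod_sum_PiE) auto
  also have "(\<Sum>i\<in>{..<r}. if i = j then t else 1) = t + real (r - 1)"
    using j by (simp add: sum.remove[of _ j])
  also have "t + real (r - 1) = real r * u"
    using r by (simp add: t_def u_def field_simps power2_eq_square of_nat_diff)
  finally have "real (card ?B) * t ^ (d + 1) \<le> (real r * u) ^ m" by simp
  also have "\<dots> = real r ^ m * ((u ^ (r - 1)) ^ d * u)"
    by (simp add: m num_points_def power_mult_distrib power_mult mult.commute[of d])
  \<comment> \<open>The \<open>+ 1\<close> in \<open>m\<close> leaves one spare factor
    \<open>u\<close>; the bound \<open>u \<le> t\<close> lets it cancel the spare factor of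
    \<open>t ^ (d + 1)\<close>.\<close>
  also have "\<dots> \<le> real r ^ m * ((u ^ (r - 1)) ^ d * t)"
    using r by (intro mult_left_mono) (auto simp: t_def u_def field_simps power2_eq_square)
  also have "\<dots> = q ^ d * real r ^ m * t ^ (d + 1)"
    using t1 by (simp add: q_def t_def[symmetric] u_def[symmetric] power_divide)
  finally show ?thesis using t1 by simp
qed

text \<open>With \<open>x = 1 / r ^ 2\<close>, Bernoulli gives
  \<open>(1 - x) ^ (r - 1) \<ge> w\<close>, so \<open>(1 + x) ^ (r - 1) * w \<le> 1\<close>. On the
  other side \<open>(1 + 1 / r) * w = 1 + 1 / r ^ 3\<close> exceeds 1, by the factorisation of
  \<open>r ^ 3 + 1\<close>.\<close>

lemma large_fibre_ratio_less_1:
  assumes "2 \<le> (r :: nat)"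
  shows "(1 + 1 / real r ^ 2) ^ (r - 1) / (1 + 1 / real r) < 1"
proof -
  define x where "x = 1 / real r ^ 2"
  define w where "w = 1 - real (r - 1) * x"
  have x: "0 \<le> x" "x \<le> 1" using assms by (auto simp: x_def field_simps)
  have w: "w = (real r ^ 2 - real r + 1) / real r ^ 2"
    using assms by (simp add: w_def x_def field_simps of_nat_diff)
  have "real r ^ 2 \<ge> real r" using assms by (simp add: power2_eq_square)
  then have "w > 0" using assms unfolding w by (intro divide_pos_pos) (linarith, simp)
  have "w \<le> (1 - x) ^ (r - 1)"
    using Bernoulli_inequality[of "- x" "r - 1"] x by (simp add: w_def)
  then have "(1 + x) ^ (r - 1) * w \<le> (1 + x) ^ (r - 1) * (1 - x) ^ (r - 1)"
    using x by (intro mult_left_mono) auto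
  also have "\<dots> = (1 - x ^ 2) ^ (r - 1)"
    by (simp add: power_mult_distrib[symmetric] algebra_simps power2_eq_square)
  also have "\<dots> \<le> 1" using x by (intro power_le_one) (auto simp: power_le_one)
  also have "1 < 1 + 1 / real r ^ 3" using assms by simp
  also have "\<dots> = (1 + 1 / real r) * w"
    using assms unfolding w by (simp add: field_simps power2_eq_square power3_eq_cube)
  finally have "(1 + x) ^ (r - 1) < 1 + 1 / real r" using \<open>w > 0\<close> by simp
  then show ?thesis using assms by (simp add: x_def add_pos_pos divide_less_eq)
qed

section \<open>Averaging over the signs\<close>

lemma max_conic_tverberg_lower_bound:
  assumes r: "2 \<le> r" and d: "2 \<le> d"
  defines "q \<equiv> (1 + 1 / real r ^ 2) ^ (r - 1) / (1 + 1 / real r)"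
  shows "(1 - real r * q ^ d) * ((real r / 2) ^ num_points d r / fact r) \<le> real (max_conic_tverberg d r)"
proof -
  define m where "m = num_points d r"
  define X where "X = max_conic_tverberg d r"
  obtain a where a: "monom_independent ({..<m} \<times> {..<d}) a"
    using ex_monom_independent[of "{..<m} \<times> {..<d}"] by auto
  let ?A = "{..<m} \<rightarrow>\<^sub>E {..<r}"
  let ?S = "{..<m} \<rightarrow>\<^sub>E {-1, 1 :: rat}"
  define B where "B j = {f \<in> ?A. d < card (fibre m f j)}" for j
  define F where "F = {f \<in> ?A. \<forall>j<r. card (fibre m f j) \<le> d}"
  define T where "T s = conic_tverberg_partitions d r (signed_point a d s ` {..<m})" for s
  define G where "G s = {f \<in> ?A. fibre_partition m r (signed_point a d s) f \<in> T s}" for s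
  have finA: "finite ?A" and finS: "finite ?S" by (simp_all add: finite_PiE)
  have card_G: "card (G s) \<le> X * fact r" if "s \<in> ?S" for s
  proof -
    have s0: "s k \<noteq> 0" if "k < m" for k using PiE_mem[OF \<open>s \<in> ?S\<close>, of k] that by auto
    have inj: "inj_on (signed_point a d s) {..<m}" using a d s0 by (rule inj_on_signed_point)
    have "finite (T s)"
      by (rule finite_subset[of _ "Pow (Pow (signed_point a d s ` {..<m}))"])
        (auto simp: T_def conic_tverberg_partitions_def partition_on_def)
    \<comment> \<open>Sorting the maps served by \<open>s\<close> by their partition leaves at most
      \<open>X\<close> groups of at most \<open>fact r\<close> maps each.\<close>
    have "G s = (\<Union>P\<in>T s. {f \<in> ?A. fibre_partition m r (signed_point a d s) f = P})"
      by (auto simp: G_def)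
    then have "card (G s) \<le> (\<Sum>P\<in>T s. card {f \<in> ?A. fibre_partition m r (signed_point a d s) f = P})"
      by (simp only: card_UN_le[OF \<open>finite (T s)\<close>])
    also have "\<dots> \<le> (\<Sum>P\<in>T s. fact r)"
    proof (rule sum_mono)
      fix P assume "P \<in> T s"
      then have "card P = r" by (simp add: T_def conic_tverberg_partitions_def)
      then show "card {f \<in> ?A. fibre_partition m r (signed_point a d s) f = P} \<le> fact r"
        using r by (intro card_fibre_partition_vimage_le inj card_ge_0_finite) auto
    qed
    also have "\<dots> = card (T s) * fact r" by simp
    also have "card (T s) \<le> X"
      unfolding X_def max_conic_tverberg_def
    proof (rule Max_ge[OF finite_conic_tverberg_counts], unfold mem_Collect_eq, intro exI conjI)
      show "generic d (signed_point a d s ` {..<m})"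
        by (rule generic_signed_points[OF a d s0])
      show "card (signed_point a d s ` {..<m}) = num_points d r"
        using inj by (simp add: card_image m_def)
    qed (simp add: T_def)
    finally show ?thesis by simp
  qed
  \<comment> \<open>Union bound: each of the \<open>r\<close> colours spoils at most a fraction
    \<open>q ^ d\<close> of all maps.\<close>
  have "?A \<subseteq> F \<union> (\<Union>j\<in>{..<r}. B j)" by (auto simp: F_def B_def not_le)
  then have "card ?A \<le> card (F \<union> (\<Union>j\<in>{..<r}. B j))"
    using finA by (intro card_mono) (auto simp: F_def B_def)
  also have "\<dots> \<le> card F + card (\<Union>j\<in>{..<r}. B j)" by (rule card_Un_le)
  also have "\<dots> \<le> card F + (\<Sum>j\<in>{..<r}. card (B j))" using card_UN_le[of "{..<r}" B] by simp
  finally have "r ^ m \<le> card F + (\<Sum>j\<in>{..<r}. card (B j))" by (simp add: card_PiE)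
  then have "real r ^ m \<le> real (card F) + (\<Sum>j\<in>{..<r}. real (card (B j)))"
    by (simp flip: of_nat_add of_nat_power of_nat_sum)
  also have "\<dots> \<le> real (card F) + (\<Sum>j\<in>{..<r}. q ^ d * real r ^ m)"
    using card_large_fibre_le[OF r _ m_def] by (intro add_left_mono sum_mono) (auto simp: B_def q_def)
  finally have low: "(1 - real r * q ^ d) * real r ^ m \<le> real (card F)" by (simp add: algebra_simps)
  have "F \<subseteq> (\<Union>s\<in>?S. G s)"
  proof
    fix f assume "f \<in> F"
    then show "f \<in> (\<Union>s\<in>?S. G s)"
      using ex_signs_fibre_partition[OF a d m_def, of f] unfolding F_def G_def T_def by blast
  qed
  then have "card F \<le> card (\<Union>s\<in>?S. G s)"
    using finA finS by (intro card_mono) (auto simp: G_def)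
  also have "\<dots> \<le> (\<Sum>s\<in>?S. card (G s))" by (rule card_UN_le[OF finS])
  also have "\<dots> \<le> (\<Sum>s\<in>?S. X * fact r)" by (rule sum_mono[OF card_G])
  also have "\<dots> = 2 ^ m * (X * fact r)" by (simp add: card_PiE numeral_2_eq_2)
  finally have "real (card F) \<le> real (2 ^ m * (X * fact r))" by (simp only: of_nat_le_iff)
  with low have "(1 - real r * q ^ d) * real r ^ m \<le> 2 ^ m * (real X * fact r)" by simp
  then show ?thesis
    by (simp add: X_def m_def power_divide field_simps)
qed

theorem theorem7p5:
  fixes r :: nat
  assumes "r \<ge> 2"
  shows "\<exists>\<epsilon> :: nat \<Rightarrow> real. \<epsilon> \<in> o(\<lambda>d. 1) \<and>
           (\<forall>d\<ge>2. real (max_conic_tverberg d r)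
                     \<ge> (1 - \<epsilon> d) * ((real r / 2) ^ num_points d r / fact r))"
proof -
  \<comment> \<open>The error term is \<open>real r * q ^ d\<close>, which decays exponentially in
    \<open>d\<close> for fixed \<open>r\<close>.\<close>
  define q where "q = (1 + 1 / real r ^ 2) ^ (r - 1) / (1 + 1 / real r)"
  have "0 \<le> q" by (simp add: q_def)
  moreover have "q < 1" unfolding q_def by (rule large_fibre_ratio_less_1[OF assms])
  ultimately have "(\<lambda>d. real r * q ^ d) \<longlonglongrightarrow> 0"
    by (intro tendsto_mult_right_zero LIMSEQ_power_zero) simp
  then have "(\<lambda>d. real r * q ^ d) \<in> o(\<lambda>d. 1)" by (intro smalloI_tendsto) simp_all
  then show ?thesis
    using max_conic_tverberg_lower_bound[OF assms] unfolding q_def by blast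
qed

end
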